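(* Let $X$ be a non-Archimedean space. Then there exists a continuous open retraction $r: B_z^1(X)\to X$ (that is, a continuous open map with $r(\{x\})=x$ for all $x\in X$) such that for any $Y\subset X$, putting $S=B_z^1(X|Y)$, the restriction $r|_S$ maps $S$ to $Y$ and $r|_S: S\to Y$ is a continuous open retraction.
   Context: A space means a regular topological space. A family of sets $\mathcal{B}$ is non-Archimedean if for all $U,V\in\mathcal{B}$ with $U\cap V\neq\varnothing$ either $U\subset V$ or $V\subset U$. A space is non-Archimedean if it has a base of its topology that is a non-Archimedean family. For a zero-dimensional space $X$, $B(X)$ denotes the set of all finite subsets of $X$, regarded as an additive Boolean group with zero $\varnothing$ and addition given by symmetric difference. $\Gamma(X)$ is the family of all partitions of $X$ into open sets. For $\gamma\in\Gamma(X)$ put $H(\gamma)=\{g\in B(X): |g\cap U| \text{ is even for all } U\in\gamma\}$, a subgroup of $B(X)$. $B_z(X)$ is the group $B(X)$ with the group topology for which the sets $H(\gamma)$, $\gamma\in\Gamma(X)$, form a subbase of neighbourhoods at the zero element. The space $X$ is identified with its image under the embedding $X\to B_z(X)$, $x\mapsto\{x\}$. Put $B_z^1(X)=\{g\in B_z(X): |g|\text{ is odd}\}$ and, for $Y\subset X$, $B_z^1(X|Y)=\{g\in B_z^1(X): g\subset Y\}$, both with the subspace topology. *)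

theory Defs
  imports "HOL-Analysis.Analysis" "HOL-Library.Disjoint_Sets"
begin

definition non_archimedean_family :: "'a set set \<Rightarrow> bool" where
  "non_archimedean_family \<B> \<longleftrightarrow>
     (\<forall>U\<in>\<B>. \<forall>V\<in>\<B>. U \<inter> V \<noteq> {} \<longrightarrow> U \<subseteq> V \<or> V \<subseteq> U)"

(* The T1 axiom is not part of regularity here, as for regular_space. *)
definition non_archimedean_space :: "'a topology \<Rightarrow> bool" where
  "non_archimedean_space X \<longleftrightarrow>
     regular_space X \<and>
     (\<exists>\<B>. non_archimedean_family \<B> \<and> openin X = arbitrary union_of (\<lambda>U. U \<in> \<B>))"

definition open_partitions :: "'a topology \<Rightarrow> 'a set set set" where
  "open_partitions X = {\<gamma>. partition_on (topspace X) \<gamma> \<and> (\<forall>U\<in>\<gamma>. openin X U)}"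

definition even_subgroup :: "'a topology \<Rightarrow> 'a set set \<Rightarrow> 'a set set" where
  "even_subgroup X \<gamma> = {g \<in> Fpow (topspace X). \<forall>U\<in>\<gamma>. even (card (g \<inter> U))}"

(* Generating by all translates of the sets H(gamma), rather than by these sets alone, makes
   this the group topology: each H(gamma) is a subgroup, so the translates that contain zero
   are exactly the sets H(gamma). See openin_bz_topology and continuous_map_bz_sym_diff. *)
definition bz_topology :: "'a topology \<Rightarrow> 'a set topology" where
  "bz_topology X = topology_generated_by
     {sym_diff g ` even_subgroup X \<gamma> | g \<gamma>. g \<in> Fpow (topspace X) \<and> \<gamma> \<in> open_partitions X}"

definition bz1_topology :: "'a topology \<Rightarrow> 'a set topology" where
  "bz1_topology X = subtopology (bz_topology X) {g. odd (card g)}"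

definition bz1_topology_on :: "'a topology \<Rightarrow> 'a set \<Rightarrow> 'a set topology" where
  "bz1_topology_on X Y = subtopology (bz1_topology X) {g. g \<subseteq> Y}"

(* The target space sits inside a space of sets via the embedding of points as singletons. *)
definition open_retraction :: "'a set topology \<Rightarrow> 'a topology \<Rightarrow> ('a set \<Rightarrow> 'a) \<Rightarrow> bool" where
  "open_retraction T Y r \<longleftrightarrow>
     continuous_map T Y r \<and> open_map T Y r \<and> (\<forall>y\<in>topspace Y. r {y} = y)"

lemma even_card_sym_diff:
  assumes "finite a" "finite b"
  shows "even (card (sym_diff a b)) \<longleftrightarrow> (even (card a) \<longleftrightarrow> even (card b))"
proof -
  have "card (sym_diff a b) = card (a - b) + card (b - a)"
    using assms by (intro card_Un_disjoint) auto
  moreover have "card a = card (a - b) + card (a \<inter> b)"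
    using assms by (metis card_Diff_subset_Int card_mono finite_Int inf_le1 le_add_diff_inverse2)
  moreover have "card b = card (b - a) + card (a \<inter> b)"
    using assms by (metis card_Diff_subset_Int card_mono finite_Int inf_le1 inf_commute le_add_diff_inverse2)
  ultimately show ?thesis by auto
qed

lemma even_subgroup_sym_diff:
  assumes "a \<in> even_subgroup X \<gamma>" "b \<in> even_subgroup X \<gamma>"
  shows "sym_diff a b \<in> even_subgroup X \<gamma>"
proof -
  have "sym_diff a b \<inter> U = sym_diff (a \<inter> U) (b \<inter> U)" for U by auto
  moreover have "finite a" "finite b"
    using assms by (auto simp: even_subgroup_def Fpow_def)
  ultimately show ?thesis
    using assms even_card_sym_diff[of "a \<inter> _" "b \<inter> _"]
    by (auto simp: even_subgroup_def Fpow_def)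
qed

lemma open_partitions_nonempty: "open_partitions X \<noteq> {}"
proof (cases "topspace X = {}")
  case True
  then have "{} \<in> open_partitions X"
    by (auto simp: open_partitions_def partition_on_def)
  then show ?thesis by blast
next
  case False
  then have "{topspace X} \<in> open_partitions X"
    by (auto simp: open_partitions_def partition_on_space)
  then show ?thesis by blast
qed

lemma even_subgroup_refinement:
  assumes \<gamma>: "\<gamma> \<in> open_partitions X" and \<delta>: "\<delta> \<in> open_partitions X"
  shows "\<exists>\<epsilon>\<in>open_partitions X. even_subgroup X \<epsilon> \<subseteq> even_subgroup X \<gamma> \<inter> even_subgroup X \<delta>"
proof -
  define \<epsilon> where "\<epsilon> = {U \<inter> V | U V. U \<in> \<gamma> \<and> V \<in> \<delta>} - {{}}"
  have ops: "\<And>U. U \<in> \<gamma> \<Longrightarrow> openin X U" "\<And>U. U \<in> \<delta> \<Longrightarrow> openin X U"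
    and un: "\<Union>\<gamma> = topspace X" "\<Union>\<delta> = topspace X"
    and dj: "disjoint \<gamma>" "disjoint \<delta>"
    using assms by (simp_all add: open_partitions_def partition_on_def)
  have "\<Union>\<epsilon> = topspace X"
  proof (intro subset_antisym subsetI)
    fix x assume x: "x \<in> topspace X"
    obtain U where U: "U \<in> \<gamma>" "x \<in> U" using x un(1) by blast
    obtain V where V: "V \<in> \<delta>" "x \<in> V" using x un(2) by blast
    from U V have "U \<inter> V \<in> \<epsilon>" "x \<in> U \<inter> V" unfolding \<epsilon>_def by blast+
    then show "x \<in> \<Union>\<epsilon>" by (rule UnionI)
  next
    fix x assume "x \<in> \<Union>\<epsilon>"
    then obtain U where "U \<in> \<gamma>" "x \<in> U" unfolding \<epsilon>_def by auto
    then show "x \<in> topspace X" using un(1) by blast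
  qed
  moreover have "disjoint \<epsilon>"
    unfolding disjoint_def
  proof (intro ballI impI)
    fix S T assume "S \<in> \<epsilon>" "T \<in> \<epsilon>" "S \<noteq> T"
    obtain U V where S: "U \<in> \<gamma>" "V \<in> \<delta>" "S = U \<inter> V"
      using \<open>S \<in> \<epsilon>\<close> unfolding \<epsilon>_def by auto
    obtain U' V' where T: "U' \<in> \<gamma>" "V' \<in> \<delta>" "T = U' \<inter> V'"
      using \<open>T \<in> \<epsilon>\<close> unfolding \<epsilon>_def by auto
    have "U \<noteq> U' \<or> V \<noteq> V'"
      using \<open>S \<noteq> T\<close> S(3) T(3) by blast
    with dj S(1,2) T(1,2) have "U \<inter> U' = {} \<or> V \<inter> V' = {}"
      by (metis disjointD)
    with S(3) T(3) show "S \<inter> T = {}" by blast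
  qed
  moreover have "\<forall>W\<in>\<epsilon>. openin X W"
    using ops unfolding \<epsilon>_def by blast
  moreover have "{} \<notin> \<epsilon>"
    by (simp add: \<epsilon>_def)
  ultimately have \<epsilon>: "\<epsilon> \<in> open_partitions X"
    by (simp add: open_partitions_def partition_on_def)
  have key: "even (card (g \<inter> U))"
    if g: "g \<in> even_subgroup X \<epsilon>" and P: "disjoint P" "\<Union>P = topspace X"
      and sub: "\<And>V. V \<in> P \<Longrightarrow> U \<inter> V \<in> \<epsilon> \<or> U \<inter> V = {}"
    for g U P
  proof -
    have fin: "finite g" and gX: "g \<subseteq> topspace X" and ev: "\<And>W. W \<in> \<epsilon> \<Longrightarrow> even (card (g \<inter> W))"
      using g by (auto simp: even_subgroup_def Fpow_def)
    define C where "C = ((\<lambda>V. g \<inter> (U \<inter> V)) ` P)"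
    have eq: "g \<inter> U = \<Union>C"
      using gX P(2) unfolding C_def by blast
    have "C \<subseteq> Pow g" unfolding C_def by blast
    then have "finite C" using fin by (simp add: finite_subset)
    moreover have "pairwise disjnt C"
      unfolding pairwise_def disjnt_def
    proof (intro ballI impI)
      fix S T assume "S \<in> C" "T \<in> C" "S \<noteq> T"
      then obtain V W where "V \<in> P" "W \<in> P" "S = g \<inter> (U \<inter> V)" "T = g \<inter> (U \<inter> W)" "V \<noteq> W"
        unfolding C_def by blast
      with P(1) show "S \<inter> T = {}" by (auto dest: disjointD)
    qed
    moreover have "finite S" if "S \<in> C" for S
      using that fin unfolding C_def by auto
    ultimately have "card (\<Union>C) = sum card C"
      by (simp add: card_Union_disjoint)
    moreover have "even (card S)" if S: "S \<in> C" for S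
    proof -
      obtain V where "V \<in> P" "S = g \<inter> (U \<inter> V)" using S unfolding C_def by blast
      with sub[of V] ev[of "U \<inter> V"] show ?thesis by auto
    qed
    ultimately show ?thesis
      using eq by (simp add: dvd_sum)
  qed
  have "even_subgroup X \<epsilon> \<subseteq> even_subgroup X \<gamma> \<inter> even_subgroup X \<delta>"
  proof
    fix g assume g: "g \<in> even_subgroup X \<epsilon>"
    have "even (card (g \<inter> U))" if "U \<in> \<gamma>" for U
      using key[OF g dj(2) un(2), of U] that unfolding \<epsilon>_def by blast
    moreover have "even (card (g \<inter> U))" if "U \<in> \<delta>" for U
      using key[OF g dj(1) un(1), of U] that unfolding \<epsilon>_def by blast
    ultimately show "g \<in> even_subgroup X \<gamma> \<inter> even_subgroup X \<delta>"
      using g by (auto simp: even_subgroup_def)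
  qed
  with \<epsilon> show ?thesis by blast
qed

lemma topspace_bz_topology: "topspace (bz_topology X) = Fpow (topspace X)"
proof -
  obtain \<gamma> where \<gamma>: "\<gamma> \<in> open_partitions X" using open_partitions_nonempty by blast
  have mem: "g \<in> sym_diff g ` even_subgroup X \<gamma>" for g
    by (rule image_eqI[of _ _ "{}"]) (auto simp: even_subgroup_def Fpow_def)
  have sub: "sym_diff g ` even_subgroup X \<delta> \<subseteq> Fpow (topspace X)"
    if "g \<in> Fpow (topspace X)" for g \<delta>
    using that by (auto simp: even_subgroup_def Fpow_def)
  show ?thesis
    unfolding bz_topology_def topology_generated_by_topspace
  proof
    show "\<Union> {sym_diff g ` even_subgroup X \<gamma> | g \<gamma>. g \<in> Fpow (topspace X) \<and> \<gamma> \<in> open_partitions X}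
            \<subseteq> Fpow (topspace X)"
    proof (rule Union_least, elim CollectE exE conjE)
      fix S g \<delta> assume "S = sym_diff g ` even_subgroup X \<delta>" "g \<in> Fpow (topspace X)"
      then show "S \<subseteq> Fpow (topspace X)" by (simp only: sub)
    qed
  next
    show "Fpow (topspace X) \<subseteq>
        \<Union> {sym_diff g ` even_subgroup X \<gamma> | g \<gamma>. g \<in> Fpow (topspace X) \<and> \<gamma> \<in> open_partitions X}"
    proof
      fix g assume "g \<in> Fpow (topspace X)"
      with \<gamma> show "g \<in> \<Union> {sym_diff g ` even_subgroup X \<gamma> | g \<gamma>.
          g \<in> Fpow (topspace X) \<and> \<gamma> \<in> open_partitions X}"
        by (intro UnionI[OF _ mem[of g]] CollectI exI[of _ g] exI[of _ \<gamma>]) simp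
    qed
  qed
qed

lemma openin_bz_topology:
  "openin (bz_topology X) W \<longleftrightarrow>
     W \<subseteq> Fpow (topspace X) \<and>
     (\<forall>g\<in>W. \<exists>\<gamma>\<in>open_partitions X. sym_diff g ` even_subgroup X \<gamma> \<subseteq> W)"
    (is "?L \<longleftrightarrow> ?R")
proof
  assume W: ?L
  then have "generate_topology_on
     {sym_diff g ` even_subgroup X \<gamma> | g \<gamma>. g \<in> Fpow (topspace X) \<and> \<gamma> \<in> open_partitions X} W"
    by (simp add: bz_topology_def openin_topology_generated_by)
  then have "\<forall>g\<in>W. \<exists>\<gamma>\<in>open_partitions X. sym_diff g ` even_subgroup X \<gamma> \<subseteq> W"
  proof (induction rule: generate_topology_on.induct)
    case Empty
    then show ?case by simp
  next
    case (Int a b)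
    show ?case
    proof
      fix g assume "g \<in> a \<inter> b"
      then have "g \<in> a" "g \<in> b" by blast+
      obtain \<gamma> where "\<gamma> \<in> open_partitions X" and s1: "sym_diff g ` even_subgroup X \<gamma> \<subseteq> a"
        using bspec[OF Int.IH(1) \<open>g \<in> a\<close>] by (elim bexE)
      obtain \<delta> where "\<delta> \<in> open_partitions X" and s2: "sym_diff g ` even_subgroup X \<delta> \<subseteq> b"
        using bspec[OF Int.IH(2) \<open>g \<in> b\<close>] by (elim bexE)
      obtain \<epsilon> where "\<epsilon> \<in> open_partitions X"
        and e: "even_subgroup X \<epsilon> \<subseteq> even_subgroup X \<gamma> \<inter> even_subgroup X \<delta>"
        using even_subgroup_refinement[OF \<open>\<gamma> \<in> open_partitions X\<close> \<open>\<delta> \<in> open_partitions X\<close>]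
        by (elim bexE)
      have "sym_diff g ` even_subgroup X \<epsilon> \<subseteq> a \<inter> b"
        using s1 s2 e by (meson Int_greatest image_mono le_infE order_trans)
      with \<open>\<epsilon> \<in> open_partitions X\<close> show "\<exists>\<gamma>\<in>open_partitions X. sym_diff g ` even_subgroup X \<gamma> \<subseteq> a \<inter> b"
        by (rule bexI[rotated])
    qed
  next
    case (UN K)
    show ?case
    proof
      fix g assume "g \<in> \<Union>K"
      then obtain k where "k \<in> K" "g \<in> k" by blast
      obtain \<gamma> where \<gamma>: "\<gamma> \<in> open_partitions X" and s: "sym_diff g ` even_subgroup X \<gamma> \<subseteq> k"
        using bspec[OF UN.IH[OF \<open>k \<in> K\<close>] \<open>g \<in> k\<close>] by (elim bexE)
      have "sym_diff g ` even_subgroup X \<gamma> \<subseteq> \<Union>K"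
        using s Union_upper[OF \<open>k \<in> K\<close>] by (rule order_trans)
      with \<gamma> show "\<exists>\<gamma>\<in>open_partitions X. sym_diff g ` even_subgroup X \<gamma> \<subseteq> \<Union>K"
        by (rule bexI[rotated])
    qed
  next
    case (Basis s)
    then obtain a \<gamma> where s: "s = sym_diff a ` even_subgroup X \<gamma>" and \<gamma>: "\<gamma> \<in> open_partitions X"
      by (elim CollectE exE conjE)
    have sub: "sym_diff g ` even_subgroup X \<gamma> \<subseteq> s" if "g \<in> s" for g
    proof
      fix x assume "x \<in> sym_diff g ` even_subgroup X \<gamma>"
      then obtain k where k: "k \<in> even_subgroup X \<gamma>" "x = sym_diff g k"
        by (elim imageE)
      have "g \<in> sym_diff a ` even_subgroup X \<gamma>"
        using that by (simp only: s)
      then obtain h where h: "h \<in> even_subgroup X \<gamma>" "g = sym_diff a h"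
        by (elim imageE)
      have "x = sym_diff a (sym_diff h k)" using h k by auto
      with even_subgroup_sym_diff[OF h(1) k(1)] show "x \<in> s"
        unfolding s by (rule rev_image_eqI)
    qed
    show ?case
      by (intro ballI bexI[OF _ \<gamma>] sub)
  qed
  moreover have "W \<subseteq> Fpow (topspace X)"
    using openin_subset[OF W] by (simp add: topspace_bz_topology)
  ultimately show ?R by (rule conjI[rotated])
next
  assume R: ?R
  show ?L
  proof (subst openin_subopen, intro ballI)
    fix g assume g: "g \<in> W"
    obtain \<gamma> where \<gamma>: "\<gamma> \<in> open_partitions X" "sym_diff g ` even_subgroup X \<gamma> \<subseteq> W"
      using bspec[OF conjunct2[OF R] g] by (elim bexE)
    have "g \<in> Fpow (topspace X)" using g R by blast
    have "openin (bz_topology X) (sym_diff g ` even_subgroup X \<gamma>)"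
      unfolding bz_topology_def using \<open>g \<in> Fpow (topspace X)\<close> \<gamma>(1)
      by (intro topology_generated_by_Basis CollectI exI[of _ g] exI[of _ \<gamma>]) simp
    moreover have "g \<in> sym_diff g ` even_subgroup X \<gamma>"
      by (rule image_eqI[of _ _ "{}"]) (auto simp: even_subgroup_def Fpow_def)
    ultimately show "\<exists>T. openin (bz_topology X) T \<and> g \<in> T \<and> T \<subseteq> W"
      using \<gamma>(2) by (intro exI[of _ "sym_diff g ` even_subgroup X \<gamma>"] conjI)
  qed
qed

lemma continuous_map_bz_sym_diff:
  "continuous_map (prod_topology (bz_topology X) (bz_topology X)) (bz_topology X)
     (\<lambda>(g, h). sym_diff g h)"
proof -
  have coset: "openin (bz_topology X) (sym_diff g ` even_subgroup X \<gamma>)"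
    if "g \<in> Fpow (topspace X)" "\<gamma> \<in> open_partitions X" for g \<gamma>
    unfolding bz_topology_def using that
    by (intro topology_generated_by_Basis CollectI exI[of _ g] exI[of _ \<gamma>]) simp
  have mem: "g \<in> sym_diff g ` even_subgroup X \<gamma>" for g \<gamma>
    by (rule image_eqI[of _ _ "{}"]) (auto simp: even_subgroup_def Fpow_def)
  show ?thesis
    unfolding continuous_map_def
  proof (intro conjI allI impI)
    show "(\<lambda>(g, h). sym_diff g h) \<in> topspace (prod_topology (bz_topology X) (bz_topology X))
            \<rightarrow> topspace (bz_topology X)"
      by (auto simp: topspace_bz_topology Fpow_def)
  next
    fix W assume W: "openin (bz_topology X) W"
    show "openin (prod_topology (bz_topology X) (bz_topology X))
      {p \<in> topspace (prod_topology (bz_topology X) (bz_topology X)). (case p of (g, h) \<Rightarrow> sym_diff g h) \<in> W}"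
      unfolding openin_prod_topology_alt
    proof (intro allI impI)
      fix a b
      assume "(a, b) \<in> {p \<in> topspace (prod_topology (bz_topology X) (bz_topology X)).
        (case p of (g, h) \<Rightarrow> sym_diff g h) \<in> W}"
      then have ab: "a \<in> Fpow (topspace X)" "b \<in> Fpow (topspace X)" "sym_diff a b \<in> W"
        by (auto simp: topspace_bz_topology)
      then obtain \<gamma> where \<gamma>: "\<gamma> \<in> open_partitions X"
        "sym_diff (sym_diff a b) ` even_subgroup X \<gamma> \<subseteq> W"
        using W unfolding openin_bz_topology by blast
      let ?U = "sym_diff a ` even_subgroup X \<gamma>" and ?V = "sym_diff b ` even_subgroup X \<gamma>"
      have "sym_diff x y \<in> W" if xy: "x \<in> ?U" "y \<in> ?V" for x y
      proof -
        obtain h k where h: "h \<in> even_subgroup X \<gamma>" "x = sym_diff a h"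
          and k: "k \<in> even_subgroup X \<gamma>" "y = sym_diff b k" using xy by blast
        have "sym_diff x y = sym_diff (sym_diff a b) (sym_diff h k)" using h k by auto
        with even_subgroup_sym_diff[OF h(1) k(1)] \<gamma>(2) show ?thesis by blast
      qed
      moreover have "openin (bz_topology X) ?U" "openin (bz_topology X) ?V"
        using ab \<gamma> coset by blast+
      moreover have "?U \<subseteq> topspace (bz_topology X)" "?V \<subseteq> topspace (bz_topology X)"
        using calculation openin_subset by blast+
      ultimately have "?U \<times> ?V \<subseteq> {p \<in> topspace (prod_topology (bz_topology X) (bz_topology X)).
          (case p of (g, h) \<Rightarrow> sym_diff g h) \<in> W}"
        unfolding topspace_prod_topology by (intro subsetI) (simp only: mem_Collect_eq split: prod.split, blast)
      with \<open>openin (bz_topology X) ?U\<close> \<open>openin (bz_topology X) ?V\<close>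
      show "\<exists>U V. openin (bz_topology X) U \<and> openin (bz_topology X) V \<and> a \<in> U \<and> b \<in> V \<and>
        U \<times> V \<subseteq> {p \<in> topspace (prod_topology (bz_topology X) (bz_topology X)).
          (case p of (g, h) \<Rightarrow> sym_diff g h) \<in> W}"
        using mem by (intro exI[of _ ?U] exI[of _ ?V] conjI)
    qed
  qed
qed

end

theory Submission
  imports Defs
begin

text \<open>
  Let \<open>\<B>\<close> be a non-Archimedean base. An odd finite set \<open>g\<close> has a point all of whose
  neighbourhoods in \<open>\<B>\<close> meet \<open>g\<close> in an odd number of points: deleting an even nonempty trace
  \<open>g \<inter> U\<close> changes no parity on the members of \<open>\<B>\<close> that contain a remaining point. The retraction
  sends \<open>g\<close> to the first such point in an order for which the members of \<open>\<B>\<close> are convex.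
  If \<open>r g \<in> V \<in> \<B>\<close>, then the members of \<open>\<B>\<close> disjoint from \<open>V\<close> amalgamate to a partition of the
  complement of \<open>V\<close>; the parities of \<open>g\<close> on \<open>V\<close> and on these pieces keep the value in \<open>V\<close>, which
  gives continuity. For openness,
  replacing \<open>g \<inter> V\<close> by a single point \<open>y \<in> V\<close> moves the value to \<open>y\<close>.
\<close>

section \<open>Parity of finite sets\<close>

lemma even_card_Int_Union:
  assumes "finite h" "disjoint \<K>" "\<And>K. K \<in> \<K> \<Longrightarrow> even (card (h \<inter> K))"
  shows "even (card (h \<inter> \<Union>\<K>))"
proof -
  \<comment> \<open>The sum runs over the distinct traces, of which there are finitely many even if
    \<open>\<K>\<close> is infinite.\<close>
  have "h \<inter> \<Union>\<K> = \<Union>((\<inter>) h ` \<K>)" by blast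
  moreover have "card (\<Union>((\<inter>) h ` \<K>)) = sum card ((\<inter>) h ` \<K>)"
    using assms(1,2) by (intro card_Union_disjoint) (auto simp: disjoint_def pairwise_def disjnt_def)
  ultimately show ?thesis
    using assms(3) by (auto intro!: dvd_sum)
qed

lemma odd_card_sym_diff_Int:
  assumes "finite g" "finite h" "even (card (h \<inter> K))"
  shows "odd (card (sym_diff g h \<inter> K)) \<longleftrightarrow> odd (card (g \<inter> K))"
proof -
  have "sym_diff g h \<inter> K = sym_diff (g \<inter> K) (h \<inter> K)" by blast
  then show ?thesis using assms even_card_sym_diff[of "g \<inter> K" "h \<inter> K"] by simp
qed

section \<open>Odd points and the order on branches\<close>

lemma ex_strict_linear_order:
  "\<exists>lt :: 'a \<Rightarrow> 'a \<Rightarrow> bool. asymp lt \<and> transp lt \<and> totalp lt"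
proof -
  obtain R :: "'a rel" where "well_order_on UNIV R"
    using well_order_on by blast
  then have "trans R" "antisym R" "total R"
    by (auto simp: well_order_on_def linear_order_on_def partial_order_on_def preorder_on_def)
  then have "asymp (\<lambda>a b. (a, b) \<in> R \<and> a \<noteq> b)" "transp (\<lambda>a b. (a, b) \<in> R \<and> a \<noteq> b)"
    "totalp (\<lambda>a b. (a, b) \<in> R \<and> a \<noteq> b)"
    by (auto simp: asymp_on_def transp_on_def totalp_on_def total_on_def
        dest: antisymD transD)
  then show ?thesis by blast
qed

text \<open>For non-Archimedean \<open>\<B>\<close> this is the union of a chain and need not be a
  member itself. With \<open>A = {y}\<close> it is the branch on which \<open>x\<close> leaves
  \<open>y\<close>; with \<open>A = V\<close> it is the block of \<open>x\<close> in the complement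
  of \<open>V\<close>.\<close>

definition avoid :: "'a set set \<Rightarrow> 'a set \<Rightarrow> 'a \<Rightarrow> 'a set" where
  "avoid \<B> A x = \<Union>{U \<in> \<B>. x \<in> U \<and> U \<inter> A = {}}"

definition odd_points :: "'a set set \<Rightarrow> 'a set \<Rightarrow> 'a set" where
  "odd_points \<B> g = {x \<in> g. \<forall>U\<in>\<B>. x \<in> U \<longrightarrow> odd (card (g \<inter> U))}"

text \<open>
  The sets compared are the two branches at which the points part in the tree \<open>\<B>\<close>. Points that
  \<open>\<B>\<close> does not separate (there may be such points, as \<open>T\<^sub>1\<close> is not assumed) are incomparable.
\<close>

definition branch_less :: "'a set set \<Rightarrow> ('a set \<Rightarrow> 'a set \<Rightarrow> bool) \<Rightarrow> 'a \<Rightarrow> 'a \<Rightarrow> bool" where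
  "branch_less \<B> lt x y \<longleftrightarrow> lt (avoid \<B> {y} x) (avoid \<B> {x} y)"

text \<open>Inseparable points are incomparable, so a minimal odd point need not be unique and one
  is chosen.\<close>

definition first_odd :: "'a set set \<Rightarrow> ('a set \<Rightarrow> 'a set \<Rightarrow> bool) \<Rightarrow> 'a set \<Rightarrow> 'a" where
  "first_odd \<B> lt g =
     (SOME x. x \<in> odd_points \<B> g \<and> (\<forall>y\<in>odd_points \<B> g. \<not> branch_less \<B> lt y x))"

lemma non_archimedean_familyD:
  "\<lbrakk>non_archimedean_family \<B>; U \<in> \<B>; V \<in> \<B>; x \<in> U; x \<in> V\<rbrakk> \<Longrightarrow> U \<subseteq> V \<or> V \<subseteq> U"
  unfolding non_archimedean_family_def by blast

section \<open>Existence of odd points\<close>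

lemma odd_points_nonempty:
  assumes "non_archimedean_family \<B>" "finite g" "odd (card g)"
  shows "odd_points \<B> g \<noteq> {}"
  using assms(2,3)
proof (induction g rule: finite_psubset_induct)
  case (psubset g)
  show ?case
  proof (cases "\<exists>U\<in>\<B>. g \<inter> U \<noteq> {} \<and> even (card (g \<inter> U))")
    case True
    then obtain U where U: "U \<in> \<B>" "g \<inter> U \<noteq> {}" "even (card (g \<inter> U))" by blast
    have split: "card (g \<inter> K) = card ((g - U) \<inter> K) + card (g \<inter> U \<inter> K)" for K
      using psubset.hyps by (subst card_Un_disjoint[symmetric]) (auto intro: arg_cong[of _ _ card])
    have "odd (card (g - U))"
      using split[of UNIV] psubset.prems U(3) by simp
    moreover have "g - U \<subset> g" using U(2) by blast
    ultimately obtain w where w: "w \<in> odd_points \<B> (g - U)"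
      using psubset.IH by blast
    have "odd (card (g \<inter> K))" if K: "K \<in> \<B>" "w \<in> K" for K
    proof -
      \<comment> \<open>\<open>w\<close> lies outside \<open>U\<close>, so a member through
        \<open>w\<close> contains \<open>U\<close> or misses it, and the deleted trace contributes
        an even number either way.\<close>
      have "\<not> K \<subseteq> U" using w K(2) by (auto simp: odd_points_def)
      then have "U \<inter> K = {} \<or> U \<inter> K = U"
        using assms(1) U(1) K(1) unfolding non_archimedean_family_def by blast
      then have "even (card (g \<inter> U \<inter> K))"
        using U(3) by (auto simp: Int_assoc)
      then show ?thesis
        using w K split[of K] by (simp add: odd_points_def)
    qed
    then show ?thesis using w by (auto simp: odd_points_def)
  next
    case False
    have "g \<noteq> {}" using psubset.prems by auto
    then show ?thesis using False by (force simp: odd_points_def)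
  qed
qed

section \<open>Convexity and transitivity of the branch order\<close>

text \<open>If \<open>U\<close> contains both points and misses \<open>A\<close>, it is comparable
  with any \<open>U'\<close> through one of them that misses \<open>A\<close>; the larger of the two
  contains both points and still misses \<open>A\<close>.\<close>

lemma avoid_eq:
  assumes "non_archimedean_family \<B>" "z \<in> avoid \<B> A x"
  shows "avoid \<B> A z = avoid \<B> A x"
proof -
  have le: "avoid \<B> A a \<subseteq> avoid \<B> A b" if "U \<in> \<B>" "a \<in> U" "b \<in> U" "U \<inter> A = {}" for U a b
  proof
    fix p assume "p \<in> avoid \<B> A a"
    then obtain U' where U': "U' \<in> \<B>" "a \<in> U'" "p \<in> U'" "U' \<inter> A = {}"
      by (auto simp: avoid_def)
    with non_archimedean_familyD[OF assms(1) that(1) U'(1) that(2) U'(2)] that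
    show "p \<in> avoid \<B> A b" unfolding avoid_def by blast
  qed
  obtain U where "U \<in> \<B>" "x \<in> U" "z \<in> U" "U \<inter> A = {}"
    using assms(2) by (auto simp: avoid_def)
  then show ?thesis using le by (intro subset_antisym) blast+
qed

text \<open>A member through \<open>z\<close> that misses the nonempty \<open>V\<close> cannot
  contain \<open>U\<close>, so it lies inside \<open>U\<close>.\<close>

lemma avoid_subset:
  assumes "non_archimedean_family \<B>" "U \<in> \<B>" "V \<subseteq> U" "V \<noteq> {}" "z \<in> U"
  shows "avoid \<B> V z \<subseteq> U"
  using assms unfolding avoid_def non_archimedean_family_def by blast

text \<open>\<open>U\<close> puts \<open>x\<close> and \<open>z\<close> on the same branch away from
  \<open>y\<close>, and a member through \<open>y\<close> contains \<open>U\<close> or misses it, so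
  it cannot tell \<open>x\<close> from \<open>z\<close>.\<close>

lemma branch_convex:
  assumes "non_archimedean_family \<B>" "U \<in> \<B>" "x \<in> U" "z \<in> U" "y \<notin> U"
  shows "branch_less \<B> lt x y \<longleftrightarrow> branch_less \<B> lt z y"
    and "branch_less \<B> lt y x \<longleftrightarrow> branch_less \<B> lt y z"
proof -
  have "z \<in> avoid \<B> {y} x" using assms by (auto simp: avoid_def)
  then have "avoid \<B> {y} x = avoid \<B> {y} z" using avoid_eq[OF assms(1)] by blast
  moreover have "y \<in> U' \<Longrightarrow> U' \<in> \<B> \<Longrightarrow> x \<in> U' \<longleftrightarrow> z \<in> U'" for U'
    using assms unfolding non_archimedean_family_def by blast
  then have "avoid \<B> {x} y = avoid \<B> {z} y" unfolding avoid_def by auto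
  ultimately show "branch_less \<B> lt x y \<longleftrightarrow> branch_less \<B> lt z y"
    and "branch_less \<B> lt y x \<longleftrightarrow> branch_less \<B> lt y z"
    unfolding branch_less_def by simp_all
qed

lemma asymp_branch_less: "asymp lt \<Longrightarrow> asymp (branch_less \<B> lt)"
  by (auto simp: branch_less_def asymp_on_def)

text \<open>Either some member contains exactly two of the three points, and convexity yields the
  claim or a contradiction; or none does, and then each point has a single branch away from the
  other two, so transitivity of \<open>lt\<close> applies.\<close>

lemma transp_branch_less:
  assumes "non_archimedean_family \<B>" "asymp lt" "transp lt"
  shows "transp (branch_less \<B> lt)"
proof (rule transpI)
  fix x y z assume xy: "branch_less \<B> lt x y" and yz: "branch_less \<B> lt y z"
  consider U where "U \<in> \<B>" "y \<in> U" "z \<in> U" "x \<notin> U" | U where "U \<in> \<B>" "x \<in> U" "y \<in> U" "z \<notin> U"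
    | U where "U \<in> \<B>" "x \<in> U" "z \<in> U" "y \<notin> U"
    | "\<forall>U\<in>\<B>. \<not> (y \<in> U \<and> z \<in> U \<and> x \<notin> U) \<and> \<not> (x \<in> U \<and> y \<in> U \<and> z \<notin> U) \<and> \<not> (x \<in> U \<and> z \<in> U \<and> y \<notin> U)"
    by blast
  then show "branch_less \<B> lt x z"
  proof cases
    case 1
    then show ?thesis using branch_convex(2)[OF assms(1)] xy by blast
  next
    case 2
    then show ?thesis using branch_convex(1)[OF assms(1)] yz by blast
  next
    case 3
    then have "branch_less \<B> lt z y" using branch_convex(1)[OF assms(1)] xy by blast
    then show ?thesis using asymp_branch_less[OF assms(2)] yz by (blast dest: asympD)
  next
    case 4
    then have "avoid \<B> {y} x = avoid \<B> {z} x" "avoid \<B> {x} y = avoid \<B> {z} y"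
      "avoid \<B> {x} z = avoid \<B> {y} z"
      unfolding avoid_def by (intro arg_cong[of _ _ Union]; blast)+
    then show ?thesis
      using xy yz assms(3) unfolding branch_less_def by (metis transpD)
  qed
qed

text \<open>Separation from one side suffices: the branch of \<open>x\<close> contains
  \<open>x\<close> and that of \<open>y\<close> does not, so they differ even if the latter is
  empty.\<close>

lemma branch_less_total:
  assumes "totalp lt" "U \<in> \<B>" "x \<in> U" "y \<notin> U"
  shows "branch_less \<B> lt x y \<or> branch_less \<B> lt y x"
proof -
  have "x \<in> avoid \<B> {y} x" "x \<notin> avoid \<B> {x} y" using assms by (auto simp: avoid_def)
  then show ?thesis using assms(1) unfolding branch_less_def by (metis totalpD)
qed

section \<open>The selection on a non-Archimedean space\<close>

locale non_archimedean_selection =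
  fixes X :: "'a topology" and \<B> :: "'a set set" and lt :: "'a set \<Rightarrow> 'a set \<Rightarrow> bool"
  assumes regular: "regular_space X"
    and nonarch: "non_archimedean_family \<B>"
    and base: "openin X = arbitrary union_of (\<lambda>U. U \<in> \<B>)"
    and lt: "asymp lt" "transp lt" "totalp lt"
begin

abbreviation r :: "'a set \<Rightarrow> 'a" where
  "r \<equiv> first_odd \<B> lt"

abbreviation prec (infix "\<sqsubset>" 50) where
  "prec \<equiv> branch_less \<B> lt"

lemma base_open: "U \<in> \<B> \<Longrightarrow> openin X U"
  by (simp add: base arbitrary_union_of_inc)

lemma base_nbhd:
  assumes "openin X W" "x \<in> W"
  obtains U where "U \<in> \<B>" "x \<in> U" "U \<subseteq> W"
  using assms unfolding base by (auto simp: union_of_def arbitrary_def)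

lemma first_odd:
  assumes "finite g" "odd (card g)"
  shows "r g \<in> odd_points \<B> g" and "y \<in> odd_points \<B> g \<Longrightarrow> \<not> y \<sqsubset> r g"
proof -
  have "finite (odd_points \<B> g)" using assms(1) by (simp add: odd_points_def)
  moreover have "odd_points \<B> g \<noteq> {}" using nonarch assms by (rule odd_points_nonempty)
  moreover have "asymp_on (odd_points \<B> g) (\<sqsubset>)" "transp_on (odd_points \<B> g) (\<sqsubset>)"
    using asymp_branch_less[OF lt(1)] transp_branch_less[OF nonarch lt(1,2)]
    by (blast intro: asymp_on_subset transp_on_subset)+
  ultimately obtain m where m: "m \<in> odd_points \<B> g" "\<forall>y\<in>odd_points \<B> g. y \<noteq> m \<longrightarrow> \<not> y \<sqsubset> m"
    using Finite_Set.bex_min_element[of "odd_points \<B> g" "(\<sqsubset>)"] by blast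
  have "\<not> m \<sqsubset> m" using asymp_branch_less[OF lt(1)] by (blast dest: asympD)
  then have "\<not> y \<sqsubset> m" if "y \<in> odd_points \<B> g" for y
    using m(2) that by (cases "y = m") auto
  with m(1) have "\<exists>x. x \<in> odd_points \<B> g \<and> (\<forall>y\<in>odd_points \<B> g. \<not> y \<sqsubset> x)" by blast
  from someI_ex[OF this]
  show "r g \<in> odd_points \<B> g" and "y \<in> odd_points \<B> g \<Longrightarrow> \<not> y \<sqsubset> r g"
    unfolding first_odd_def by blast+
qed

lemma first_odd_in: "\<lbrakk>finite g; odd (card g)\<rbrakk> \<Longrightarrow> r g \<in> g"
  using first_odd(1) by (auto simp: odd_points_def)

lemma first_odd_singleton: "r {x} = x"
  using first_odd_in[of "{x}"] by simp

section \<open>The partition cut out by a basic open set\<close>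

text \<open>Regularity enters here. A member through \<open>z\<close> that misses a nonempty closed
  \<open>C \<subseteq> V\<close> cannot contain \<open>V\<close>, nor lie in \<open>V\<close>, so it
  misses \<open>V\<close>.\<close>

lemma mem_avoid:
  assumes "V \<in> \<B>" "z \<in> topspace X - V"
  shows "z \<in> avoid \<B> V z"
proof (cases "V = {}")
  case True
  then show ?thesis using base_nbhd[of "topspace X" z] assms by (auto simp: avoid_def)
next
  case False
  then obtain x where x: "x \<in> V" by blast
  obtain N C where N: "openin X N" "closedin X C" "x \<in> N" "N \<subseteq> C" "C \<subseteq> V"
    using regular base_open[OF assms(1)] x
    unfolding neighbourhood_base_of_closedin[symmetric] neighbourhood_base_of by meson
  have "z \<in> topspace X - C" "openin X (topspace X - C)" using assms(2) N by auto
  then obtain U where U: "U \<in> \<B>" "z \<in> U" "U \<subseteq> topspace X - C" using base_nbhd by metis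
  have "\<not> V \<subseteq> U" using x N(3,4) U(3) by blast
  moreover have "\<not> U \<subseteq> V" using U(2) assms(2) by blast
  ultimately have "U \<inter> V = {}"
    using nonarch U(1) assms(1) unfolding non_archimedean_family_def by blast
  then show ?thesis using U by (auto simp: avoid_def)
qed

text \<open>For nonempty \<open>V\<close> in \<open>\<B>\<close>, every member containing
  \<open>V\<close> is a union of these blocks, so the parities on blocks determine those on all such
  members.\<close>

definition cut :: "'a set \<Rightarrow> 'a set set" where
  "cut V = insert V (avoid \<B> V ` (topspace X - V))"

lemma cut_open_partition:
  assumes "V \<in> \<B>" "V \<noteq> {}"
  shows "cut V \<in> open_partitions X"
proof -
  have open_avoid: "openin X (avoid \<B> V z)" for z
    unfolding avoid_def using base_open by auto
  have disj: "V \<inter> avoid \<B> V z = {}" for z by (auto simp: avoid_def)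
  have "\<Union>(cut V) = topspace X"
  proof
    show "\<Union>(cut V) \<subseteq> topspace X"
      using openin_subset[OF open_avoid] openin_subset[OF base_open[OF assms(1)]]
      by (auto simp: cut_def)
    show "topspace X \<subseteq> \<Union>(cut V)"
      using mem_avoid[OF assms(1)] by (auto simp: cut_def)
  qed
  moreover have "avoid \<B> V y = avoid \<B> V z" if "p \<in> avoid \<B> V y" "p \<in> avoid \<B> V z" for p y z
    using that avoid_eq[OF nonarch] by metis
  then have "avoid \<B> V y \<inter> avoid \<B> V z = {}" if "avoid \<B> V y \<noteq> avoid \<B> V z" for y z
    using that by blast
  then have "disjoint (cut V)"
    using disj by (simp add: cut_def disjoint_def Int_commute)
  moreover have "{} \<notin> cut V" using assms(2) mem_avoid[OF assms(1)] by (auto simp: cut_def)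
  ultimately show ?thesis
    using open_avoid base_open[OF assms(1)] by (auto simp: open_partitions_def partition_on_def cut_def)
qed

section \<open>Stability and continuity of the selection\<close>

text \<open>Parities on blocks survive adding \<open>h\<close>, which produces an odd point of the
  new set inside \<open>V\<close>. A new value outside \<open>V\<close> would lie in a block
  containing an odd point of \<open>g\<close> that precedes \<open>r g\<close>.\<close>

lemma first_odd_stable:
  assumes g: "g \<subseteq> topspace X" "finite g" "odd (card g)" and V: "V \<in> \<B>" "r g \<in> V"
    and h: "h \<in> even_subgroup X (cut V)"
  shows "odd (card (sym_diff g h))" and "r (sym_diff g h) \<in> V"
proof -
  define g' where "g' = sym_diff g h"
  have part: "disjoint (cut V)" "\<Union>(cut V) = topspace X"
    using cut_open_partition[of V] V by (auto simp: open_partitions_def partition_on_def)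
  have fin: "finite h" "finite g'" and sub: "h \<subseteq> topspace X" "g' \<subseteq> topspace X"
    using h g by (auto simp: even_subgroup_def Fpow_def g'_def)
  have parity: "odd (card (g' \<inter> \<Union>\<K>)) \<longleftrightarrow> odd (card (g \<inter> \<Union>\<K>))" if "\<K> \<subseteq> cut V" for \<K>
  proof -
    have "disjoint \<K>" using part(1) that by (rule pairwise_subset)
    moreover have "even (card (h \<inter> K))" if "K \<in> \<K>" for K
      using h that \<open>\<K> \<subseteq> cut V\<close> by (auto simp: even_subgroup_def)
    ultimately show ?thesis
      unfolding g'_def by (intro odd_card_sym_diff_Int even_card_Int_Union fin g(2))
  qed
  show odd': "odd (card (sym_diff g h))"
    using parity[of "cut V"] part(2) sub g by (simp add: g'_def[symmetric] Int_absorb2)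
  have parity_V: "odd (card (g' \<inter> V)) \<longleftrightarrow> odd (card (g \<inter> V))"
    using parity[of "{V}"] by (simp add: cut_def)
  have parity_avoid: "odd (card (g' \<inter> avoid \<B> V z)) \<longleftrightarrow> odd (card (g \<inter> avoid \<B> V z))"
    if "z \<in> topspace X - V" for z
    using parity[of "{avoid \<B> V z}"] that by (simp add: cut_def)
  have parity_up: "odd (card (g' \<inter> U)) \<longleftrightarrow> odd (card (g \<inter> U))" if U: "U \<in> \<B>" "V \<subseteq> U" for U
  proof -
    have "U = \<Union>{K \<in> cut V. K \<subseteq> U}"
    proof
      show "U \<subseteq> \<Union>{K \<in> cut V. K \<subseteq> U}"
      proof
        fix z assume z: "z \<in> U"
        show "z \<in> \<Union>{K \<in> cut V. K \<subseteq> U}"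
        proof (cases "z \<in> V")
          case True
          then show ?thesis using U(2) by (auto simp: cut_def)
        next
          case False
          then have "z \<in> topspace X - V" using z openin_subset[OF base_open[OF U(1)]] by blast
          moreover have "avoid \<B> V z \<subseteq> U"
            using avoid_subset[OF nonarch U _ z] V(2) by blast
          ultimately show ?thesis using mem_avoid[OF V(1)] by (auto simp: cut_def)
        qed
      qed
    qed blast
    then show ?thesis using parity[of "{K \<in> cut V. K \<subseteq> U}"] by simp
  qed
  have odd_up: "odd (card (g \<inter> U))" if "U \<in> \<B>" "V \<subseteq> U" for U
    using first_odd(1)[OF g(2,3)] V(2) that by (auto simp: odd_points_def)
  \<comment> \<open>For \<open>U\<close> inside \<open>W\<close> the sets \<open>f\<close> and
    \<open>f \<inter> W\<close> have the same trace on \<open>U\<close>, so an odd point of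
    \<open>f \<inter> W\<close> serves.\<close>
  have descend: "\<exists>w\<in>W \<inter> f. \<forall>U\<in>\<B>. w \<in> U \<longrightarrow> U \<subseteq> W \<longrightarrow> odd (card (f \<inter> U))"
    if "finite f" "odd (card (f \<inter> W))" for f W
    using odd_points_nonempty[OF nonarch, of "f \<inter> W"] that
    by (fastforce simp: odd_points_def Int_assoc Int_absorb1)
  have cases: "U \<subseteq> V \<or> V \<subseteq> U \<or> U \<inter> V = {}" if "U \<in> \<B>" for U
    using nonarch that V(1) unfolding non_archimedean_family_def by blast

  obtain v where v: "v \<in> V \<inter> g'" "\<forall>U\<in>\<B>. v \<in> U \<longrightarrow> U \<subseteq> V \<longrightarrow> odd (card (g' \<inter> U))"
    using descend[of g' V] fin(2) parity_V odd_up[OF V(1)] by auto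
  have "odd (card (g' \<inter> U))" if U: "U \<in> \<B>" "v \<in> U" for U
  proof (cases "V \<subseteq> U")
    case True
    then show ?thesis using parity_up[OF U(1)] odd_up[OF U(1)] by blast
  next
    case False
    then have "U \<subseteq> V" using cases[OF U(1)] v(1) U(2) by blast
    then show ?thesis using v(2) U by blast
  qed
  then have v_odd: "v \<in> odd_points \<B> g'" using v(1) by (simp add: odd_points_def)
  define x' where "x' = r g'"
  have x': "x' \<in> odd_points \<B> g'" "\<not> v \<sqsubset> x'"
    using first_odd[OF fin(2) odd'[folded g'_def]] v_odd by (auto simp: x'_def)
  show "r (sym_diff g h) \<in> V"
  proof (rule ccontr)
    assume "r (sym_diff g h) \<notin> V"
    then have x'V: "x' \<in> topspace X - V" "x' \<notin> V"
      using x'(1) sub by (auto simp: x'_def g'_def odd_points_def)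
    define W where "W = avoid \<B> V x'"
    have "x' \<sqsubset> v \<or> v \<sqsubset> x'" using branch_less_total[OF lt(3) V(1)] v(1) x'V by blast
    \<comment> \<open>Minimality of \<open>x'\<close> against \<open>v\<close> puts
      \<open>x'\<close> first; convexity of \<open>V\<close> then replaces \<open>v\<close> by
      \<open>r g\<close>.\<close>
    then have before: "x' \<sqsubset> r g"
      using x'(2) branch_convex(2)[OF nonarch V(1) _ V(2) x'V(2)] v(1) by blast
    have x'W: "x' \<in> W" using mem_avoid[OF V(1) x'V(1)] by (simp add: W_def)
    \<comment> \<open>\<open>W\<close> is the union of a chain, so every finite subset lies in one of its members.\<close>
    have attained: "\<exists>U\<in>\<B>. x' \<in> U \<and> U \<subseteq> W \<and> f \<subseteq> U" if "finite f" "f \<subseteq> W" for f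
      using that
    proof induction
      case empty
      then show ?case using x'W unfolding W_def avoid_def by blast
    next
      case (insert p f)
      then obtain U where U: "U \<in> \<B>" "x' \<in> U" "U \<subseteq> W" "f \<subseteq> U" by auto
      obtain U' where U': "U' \<in> \<B>" "x' \<in> U'" "U' \<subseteq> W" "p \<in> U'"
      proof -
        obtain U' where "U' \<in> \<B>" "x' \<in> U'" "p \<in> U'" "U' \<inter> V = {}"
          using insert.prems by (auto simp: W_def avoid_def)
        moreover from this have "U' \<subseteq> W" by (auto simp: W_def avoid_def)
        ultimately show thesis using that by blast
      qed
      from non_archimedean_familyD[OF nonarch U(1) U'(1) U(2) U'(2)] show ?case
      proof
        assume "U \<subseteq> U'"
        then show ?thesis using U(4) U' by (intro bexI[of _ U']) auto
      next
        assume "U' \<subseteq> U"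
        then show ?thesis using U U'(4) by (intro bexI[of _ U]) auto
      qed
    qed
    \<comment> \<open>\<open>W\<close> may fail to belong to \<open>\<B>\<close>, while oddness at
      \<open>x'\<close> speaks of members only; \<open>U\<close> is a member with the same trace of
      \<open>g'\<close>.\<close>
    obtain U where U: "U \<in> \<B>" "x' \<in> U" "U \<subseteq> W" "g' \<inter> W \<subseteq> U"
      using attained[of "g' \<inter> W"] fin by auto
    then have "g' \<inter> W = g' \<inter> U" by blast
    then have "odd (card (g' \<inter> W))" using x'(1) U by (simp add: odd_points_def)
    then have "odd (card (g \<inter> W))" using parity_avoid[OF x'V(1)] by (simp add: W_def)
    then obtain w where w: "w \<in> W \<inter> g" "\<forall>U\<in>\<B>. w \<in> U \<longrightarrow> U \<subseteq> W \<longrightarrow> odd (card (g \<inter> U))"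
      using descend[of g W] g(2) by blast
    have "w \<notin> V" using w(1) by (auto simp: W_def avoid_def)
    have below: "U \<subseteq> W" if "U \<in> \<B>" "w \<in> U" "U \<inter> V = {}" for U
    proof -
      have "U \<subseteq> avoid \<B> V w" using that by (auto simp: avoid_def)
      then show ?thesis using avoid_eq[OF nonarch, of w V x'] w(1) by (simp add: W_def)
    qed
    have "odd (card (g \<inter> U))" if U: "U \<in> \<B>" "w \<in> U" for U
    proof (cases "V \<subseteq> U")
      case True
      then show ?thesis using odd_up[OF U(1)] by blast
    next
      case False
      then have "U \<inter> V = {}" using cases[OF U(1)] U(2) \<open>w \<notin> V\<close> by blast
      then show ?thesis using w(2) U below[OF U] by blast
    qed
    then have "w \<in> odd_points \<B> g" using w(1) by (simp add: odd_points_def)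
    then have "\<not> w \<sqsubset> r g" using first_odd(2)[OF g(2,3)] by blast
    \<comment> \<open>\<open>K\<close> joins \<open>x'\<close> to \<open>w\<close> and excludes
      \<open>r g\<close>, so by convexity \<open>w\<close> precedes \<open>r g\<close> just as
      \<open>x'\<close> does.\<close>
    obtain K where K: "K \<in> \<B>" "x' \<in> K" "w \<in> K" "K \<inter> V = {}"
      using w(1) by (auto simp: W_def avoid_def)
    then show False
      using branch_convex(1)[OF nonarch K(1,2,3), of "r g"] before \<open>\<not> w \<sqsubset> r g\<close> V(2) by blast
  qed
qed

lemma topspace_bz1_on:
  "topspace (bz1_topology_on X Y) = {g. g \<subseteq> topspace X \<inter> Y \<and> finite g \<and> odd (card g)}"
  by (auto simp: bz1_topology_on_def bz1_topology_def topspace_bz_topology Fpow_def)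

lemma first_odd_continuous: "continuous_map (bz1_topology X) X r"
  unfolding continuous_map_def
proof (intro conjI allI impI)
  show "r \<in> topspace (bz1_topology X) \<rightarrow> topspace X"
    using first_odd_in by (auto simp: bz1_topology_def topspace_bz_topology Fpow_def)
next
  fix W assume W: "openin X W"
  \<comment> \<open>\<open>T\<close> is shown open in the whole group: adding an element of
    \<open>even_subgroup X (cut V)\<close> preserves oddness as well as the value in
    \<open>V\<close>.\<close>
  define T where "T = {g \<in> Fpow (topspace X). odd (card g) \<and> r g \<in> W}"
  have "openin (bz_topology X) T"
    unfolding openin_bz_topology
  proof (intro conjI ballI)
    fix g assume "g \<in> T"
    then have g: "g \<subseteq> topspace X" "finite g" "odd (card g)" "r g \<in> W"
      by (auto simp: T_def Fpow_def)
    obtain V where V: "V \<in> \<B>" "r g \<in> V" "V \<subseteq> W" using base_nbhd[OF W g(4)] .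
    have "sym_diff g h \<in> T" if h: "h \<in> even_subgroup X (cut V)" for h
    proof -
      have "sym_diff g h \<in> Fpow (topspace X)"
        using h g by (auto simp: even_subgroup_def Fpow_def)
      then show ?thesis
        using first_odd_stable[OF g(1-3) V(1,2) h] V(3) by (auto simp: T_def)
    qed
    then show "\<exists>\<gamma>\<in>open_partitions X. sym_diff g ` even_subgroup X \<gamma> \<subseteq> T"
      using cut_open_partition[OF V(1)] V(2) by blast
  qed (auto simp: T_def)
  moreover have "{g \<in> topspace (bz1_topology X). r g \<in> W} = T \<inter> {g. odd (card g)}"
    by (auto simp: T_def bz1_topology_def topspace_bz_topology)
  ultimately show "openin (bz1_topology X) {g \<in> topspace (bz1_topology X). r g \<in> W}"
    by (auto simp: bz1_topology_def openin_subtopology)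
qed

section \<open>Openness of the selection\<close>

text \<open>An odd trace gives way to one point, so parities on sets containing or missing
  \<open>V\<close> stay, and \<open>y\<close> becomes odd. A competitor outside \<open>V\<close> is
  odd for \<open>g\<close> too, and convexity of \<open>V\<close> compares it with \<open>y\<close>
  as with \<open>r g\<close>.\<close>

lemma first_odd_replace:
  assumes g: "finite g" "odd (card g)" and V: "V \<in> \<B>" "r g \<in> V" and y: "y \<in> V"
  shows "odd (card (insert y (g - V)))" and "r (insert y (g - V)) = y"
proof -
  define g' where "g' = insert y (g - V)"
  have x: "r g \<in> odd_points \<B> g" using first_odd(1)[OF g] .
  have odd_V: "odd (card (g \<inter> V))" using x V by (simp add: odd_points_def)
  have parity: "odd (card (g' \<inter> K)) \<longleftrightarrow> odd (card (g \<inter> K))" if "V \<subseteq> K \<or> K \<inter> V = {}" for K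
  proof (cases "V \<subseteq> K")
    case True
    have "card (g' \<inter> K) = Suc (card ((g - V) \<inter> K))"
      using True y g(1) by (auto simp: g'_def card_insert_if)
    moreover have "card (g \<inter> K) = card ((g - V) \<inter> K) + card (g \<inter> V)"
      using True g(1) by (subst card_Un_disjoint[symmetric]) (auto intro: arg_cong[of _ _ card])
    ultimately show ?thesis using odd_V by simp
  next
    case False
    then have "g' \<inter> K = g \<inter> K" using that y by (auto simp: g'_def)
    then show ?thesis by simp
  qed
  have fin: "finite g'" using g by (simp add: g'_def)
  show odd': "odd (card (insert y (g - V)))"
    using parity[of UNIV] g by (simp add: g'_def)
  have nested: "U \<subseteq> V \<or> V \<subseteq> U \<or> U \<inter> V = {}" if "U \<in> \<B>" for U
    using nonarch that V(1) unfolding non_archimedean_family_def by blast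
  have "odd (card (g' \<inter> U))" if U: "U \<in> \<B>" "y \<in> U" for U
  proof (cases "V \<subseteq> U")
    case True
    then show ?thesis using parity[of U] x V U by (auto simp: odd_points_def)
  next
    case False
    then have "g' \<inter> U = {y}" using nested[OF U(1)] U(2) y by (auto simp: g'_def)
    then show ?thesis by simp
  qed
  then have y_odd: "y \<in> odd_points \<B> g'" by (simp add: odd_points_def g'_def)
  show "r (insert y (g - V)) = y"
  proof (rule ccontr)
    define x' where "x' = r g'"
    assume "r (insert y (g - V)) \<noteq> y"
    then have "x' \<noteq> y" by (simp add: x'_def g'_def)
    have x': "x' \<in> odd_points \<B> g'" "\<not> y \<sqsubset> x'"
      using first_odd[OF fin odd'[folded g'_def]] y_odd by (auto simp: x'_def)
    then have "x' \<in> g - V" using \<open>x' \<noteq> y\<close> by (auto simp: odd_points_def g'_def)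
    have "odd (card (g \<inter> U))" if U: "U \<in> \<B>" "x' \<in> U" for U
      using parity[of U] nested[OF U(1)] x'(1) \<open>x' \<in> g - V\<close> U by (auto simp: odd_points_def)
    then have "x' \<in> odd_points \<B> g" using \<open>x' \<in> g - V\<close> by (simp add: odd_points_def)
    then have "\<not> x' \<sqsubset> r g" using first_odd(2)[OF g] by blast
    then have "\<not> x' \<sqsubset> y"
      using branch_convex(2)[OF nonarch V(1) V(2) y, of x'] \<open>x' \<in> g - V\<close> by blast
    then show False
      using branch_less_total[OF lt(3) V(1) y, of x'] x'(2) \<open>x' \<in> g - V\<close> by blast
  qed
qed

text \<open>The witness for a value \<open>y\<close> near \<open>r g\<close> is \<open>g\<close>
  with its trace on \<open>V\<close> replaced by \<open>y\<close>. It stays inside \<open>Y\<close>,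
  which is why the same map is open for every \<open>Y\<close>.\<close>

lemma first_odd_open:
  assumes Y: "Y \<subseteq> topspace X"
  shows "open_map (bz1_topology_on X Y) (subtopology X Y) r"
  unfolding open_map_def
proof (intro allI impI)
  fix S assume S: "openin (bz1_topology_on X Y) S"
  then obtain T where T: "openin (bz_topology X) T" "S = T \<inter> {g. odd (card g)} \<inter> {g. g \<subseteq> Y}"
    by (auto simp: bz1_topology_on_def bz1_topology_def openin_subtopology)
  show "openin (subtopology X Y) (r ` S)"
  proof (subst openin_subopen, intro ballI)
    fix x assume "x \<in> r ` S"
    then obtain g where g: "g \<in> S" "x = r g" by blast
    have "g \<in> topspace (bz1_topology_on X Y)" using openin_subset[OF S] g(1) by blast
    then have g': "finite g" "odd (card g)" "g \<subseteq> Y" by (auto simp: topspace_bz1_on)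
    have x: "x \<in> Y" using first_odd_in[OF g'(1,2)] g'(3) g(2) by blast
    obtain \<gamma> where \<gamma>: "\<gamma> \<in> open_partitions X" "sym_diff g ` even_subgroup X \<gamma> \<subseteq> T"
      using T g(1) unfolding openin_bz_topology by blast
    obtain G where G: "G \<in> \<gamma>" "x \<in> G" "openin X G" and disj: "disjoint \<gamma>"
      using \<gamma>(1) x Y unfolding open_partitions_def partition_on_def by blast
    \<comment> \<open>With \<open>V\<close> inside one block \<open>G\<close>, the change from
      \<open>g\<close> to \<open>f\<close> meets no other block, and on \<open>G\<close> it is even
      as a difference of two odd sets.\<close>
    obtain V where V: "V \<in> \<B>" "x \<in> V" "V \<subseteq> G" using base_nbhd[OF G(3,2)] .
    have "y \<in> r ` S" if y: "y \<in> V \<inter> Y" for y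
    proof -
      define f where "f = insert y (g - V)"
      have f: "odd (card f)" "r f = y"
        using first_odd_replace[OF g'(1,2) V(1)] V(2) y g(2) by (auto simp: f_def)
      have fin: "finite f" "f \<subseteq> Y" using g' y by (auto simp: f_def)
      have sub: "sym_diff g f \<subseteq> V" using y by (auto simp: f_def)
      have "even (card (sym_diff g f \<inter> K))" if "K \<in> \<gamma>" for K
      proof (cases "K = G")
        case True
        then have "sym_diff g f \<inter> K = sym_diff g f" using sub V(3) by blast
        then show ?thesis using even_card_sym_diff[OF g'(1) fin(1)] g'(2) f(1) by simp
      next
        case False
        then have "K \<inter> G = {}" using disj that G(1) by (auto dest: disjointD)
        then have "sym_diff g f \<inter> K = {}" using sub V(3) by blast
        then show ?thesis by simp
      qed
      then have "sym_diff g f \<in> even_subgroup X \<gamma>"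
        using g' fin Y by (auto simp: even_subgroup_def Fpow_def)
      moreover have "f = sym_diff g (sym_diff g f)" by blast
      ultimately have "f \<in> T" using \<gamma>(2) by blast
      then show ?thesis using T(2) f fin(2) by blast
    qed
    moreover have "openin (subtopology X Y) (V \<inter> Y)"
      using base_open[OF V(1)] by (auto simp: openin_subtopology)
    ultimately show "\<exists>T. openin (subtopology X Y) T \<and> x \<in> T \<and> T \<subseteq> r ` S"
      using V(2) x by blast
  qed
qed

section \<open>The retraction and its restrictions\<close>

lemma first_odd_image: "r ` topspace (bz1_topology_on X Y) \<subseteq> Y"
  using first_odd_in by (auto simp: topspace_bz1_on)

lemma first_odd_open_retraction:
  assumes "Y \<subseteq> topspace X"
  shows "open_retraction (bz1_topology_on X Y) (subtopology X Y) r"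
proof -
  have "continuous_map (bz1_topology_on X Y) X r"
    unfolding bz1_topology_on_def by (rule continuous_map_from_subtopology[OF first_odd_continuous])
  then show ?thesis
    using first_odd_image first_odd_open[OF assms] first_odd_singleton
    by (auto simp: open_retraction_def continuous_map_in_subtopology)
qed

end

theorem theorem1:
  fixes X :: "'a topology"
  assumes "non_archimedean_space X"
  shows "\<exists>r :: 'a set \<Rightarrow> 'a.
           open_retraction (bz1_topology X) X r \<and>
           (\<forall>Y. Y \<subseteq> topspace X \<longrightarrow>
              r ` topspace (bz1_topology_on X Y) \<subseteq> Y \<and>
              open_retraction (bz1_topology_on X Y) (subtopology X Y) r)"
proof -
  obtain \<B> where "regular_space X" "non_archimedean_family \<B>"
    "openin X = arbitrary union_of (\<lambda>U. U \<in> \<B>)"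
    using assms unfolding non_archimedean_space_def by blast
  moreover obtain lt :: "'a set \<Rightarrow> 'a set \<Rightarrow> bool" where "asymp lt" "transp lt" "totalp lt"
    using ex_strict_linear_order by blast
  ultimately interpret non_archimedean_selection X \<B> lt
    by unfold_locales
  \<comment> \<open>The unrestricted retraction is the case \<open>Y = topspace X\<close>.\<close>
  have "bz1_topology_on X (topspace X) = bz1_topology X"
    unfolding bz1_topology_on_def
    by (rule subtopology_superset) (auto simp: bz1_topology_def topspace_bz_topology Fpow_def)
  then have "open_retraction (bz1_topology X) X (first_odd \<B> lt)"
    using first_odd_open_retraction[of "topspace X"] by simp
  then show ?thesis
    using first_odd_image first_odd_open_retraction by blast
qed

end
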